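(* Let $0<L<\infty$, let $G,B\in\mathbb{R}$ be constants with $G^2+B^2\neq 0$, and let $\tilde p,\tilde q:[0,L]\to\mathbb{R}$ be continuous. Then there exists a constant $\varepsilon>0$ such that the two-point boundary value problem $$\frac{d\theta}{dx}=-\frac{s}{v^2},\qquad \frac{dv}{dx}=w,\qquad \frac{ds}{dx}=\varepsilon\,\frac{B\tilde p(x)-G\tilde q(x)}{G^2+B^2},\qquad \frac{dw}{dx}=\frac{s^2}{v^3}-\varepsilon\,\frac{G\tilde p(x)+B\tilde q(x)}{v\,(G^2+B^2)}$$ for $x\in[0,L]$, with boundary conditions $$\theta(0)=0,\qquad v(0)=1,\qquad s(L)=0,\qquad w(L)=0,$$ has a solution $(\theta,v,s,w)$ with $\theta,v,s,w\in C^1[0,L]$ and $v(x)\neq 0$ for all $x\in[0,L]$.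
   Context: $C^r[0,L]$ denotes the space of $r$-times continuously differentiable real-valued functions on the closed interval $[0,L]$ (one-sided derivatives at the endpoints); $C^0[0,L]$ is the space of continuous functions. A solution is a quadruple of functions on $[0,L]$ satisfying the four differential equations at every $x\in[0,L]$ together with the four boundary conditions. The equations require $v\neq0$. *)

theory Defs
  imports "HOL-Analysis.Analysis"
begin

text \<open>
  The space \<open>C\<^sup>1[a,b]\<close> with one-sided derivatives at the endpoints. The library predicate
  \<^const>\<open>C1_differentiable_on\<close> asks for two-sided derivatives at \<open>a\<close> and \<open>b\<close>, hence depends on
  values outside the interval; derivatives here are taken within \<open>{a..b}\<close>.
\<close>

definition C1_on_Icc :: "real \<Rightarrow> real \<Rightarrow> (real \<Rightarrow> real) \<Rightarrow> bool" where
  "C1_on_Icc a b f \<longleftrightarrow>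
     (\<exists>f'. (\<forall>x\<in>{a..b}. (f has_real_derivative f' x) (at x within {a..b})) \<and>
           continuous_on {a..b} f')"

end

theory Submission
  imports Defs
begin

text \<open>
  The equation for \<open>s\<close> decouples and gives \<open>s = \<epsilon> S\<close> with \<open>S\<close> independent of \<open>\<epsilon>\<close>. What remains
  is the mixed boundary value problem \<open>v'' = h(x, v)\<close>, \<open>v(0) = 1\<close>, \<open>v'(L) = 0\<close>, where both \<open>h\<close> and
  its Lipschitz constant in \<open>v\<close> are \<open>O(\<epsilon>)\<close> on \<open>\<bar>v - 1\<bar> \<le> 1/2\<close>. For small \<open>\<epsilon>\<close> the operator
  \<open>v \<mapsto> 1 - \<integral>\<^sub>0\<^sup>x \<integral>\<^sub>y\<^sup>L h(t, v(t)) dt dy\<close> is therefore a contraction of the closed ball of radius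
  \<open>1/2\<close> about the constant \<open>1\<close> in the space of continuous functions; \<open>\<theta>\<close> is then a quadrature.
\<close>

lemma continuous_on_iterated_integral:
  fixes g :: "real \<Rightarrow> real"
  assumes "continuous_on {a..b} g"
  shows "continuous_on {a..b} (\<lambda>x. integral {a..x} (\<lambda>y. integral {y..b} g))"
  by (intro indefinite_integral_continuous_1 integrable_continuous_real
      indefinite_integral_continuous_1' assms)

text \<open>Inner and outer integration each run over an interval of length at most
  \<open>b - a\<close>, and each costs one such factor. The bound serves twice: with
  \<open>M\<close> a bound on the right-hand side it keeps the ball invariant, and with
  \<open>M\<close> a bound on a difference of right-hand sides it gives the contraction.\<close>

lemma abs_iterated_integral_le:
  fixes g :: "real \<Rightarrow> real"
  assumes "continuous_on {a..b} g" and bound: "\<And>t. t \<in> {a..b} \<Longrightarrow> \<bar>g t\<bar> \<le> M"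
    and x: "x \<in> {a..b}"
  shows "\<bar>integral {a..x} (\<lambda>y. integral {y..b} g)\<bar> \<le> M * (b - a)\<^sup>2"
proof -
  have M: "0 \<le> M"
    using bound[OF x] by linarith
  have inner: "norm (integral {y..b} g) \<le> M * (b - a)" if "y \<in> {a..x}" for y
  proof -
    have "norm (integral {y..b} g) \<le> M * (b - y)"
      using that x bound by (intro integral_bound continuous_on_subset[OF assms(1)]) auto
    also have "\<dots> \<le> M * (b - a)"
      using M that by (intro mult_left_mono) auto
    finally show ?thesis .
  qed
  have "continuous_on {a..x} (\<lambda>y. integral {y..b} g)"
    using x by (intro continuous_on_subset[OF indefinite_integral_continuous_1'
          [OF integrable_continuous_real[OF assms(1)]]]) auto
  then have "norm (integral {a..x} (\<lambda>y. integral {y..b} g)) \<le> M * (b - a) * (x - a)"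
    using x inner by (intro integral_bound) auto
  also have "\<dots> \<le> M * (b - a) * (b - a)"
    using M x by (intro mult_left_mono) auto
  finally show ?thesis
    by (simp add: power2_eq_square mult.assoc)
qed

text \<open>Linearity merges the difference of two images of the operator into one iterated
  integral, to which the preceding bound applies.\<close>

lemma iterated_integral_diff:
  fixes f g :: "real \<Rightarrow> real"
  assumes f: "continuous_on {a..b} f" and g: "continuous_on {a..b} g" and x: "x \<in> {a..b}"
  shows "integral {a..x} (\<lambda>y. integral {y..b} f) - integral {a..x} (\<lambda>y. integral {y..b} g)
    = integral {a..x} (\<lambda>y. integral {y..b} (\<lambda>t. f t - g t))"
proof -
  have int: "(\<lambda>y. integral {y..b} k) integrable_on {a..x}" if "continuous_on {a..b} k" for k :: "real \<Rightarrow> real"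
    using x by (intro integrable_continuous_real continuous_on_subset
        [OF indefinite_integral_continuous_1'[OF integrable_continuous_real[OF that]]]) auto
  have "integral {y..b} (\<lambda>t. f t - g t) = integral {y..b} f - integral {y..b} g"
    if "y \<in> {a..x}" for y
    using that x
    by (intro integral_diff integrable_continuous_real
        continuous_on_subset[OF f] continuous_on_subset[OF g]) auto
  then have "integral {a..x} (\<lambda>y. integral {y..b} (\<lambda>t. f t - g t))
      = integral {a..x} (\<lambda>y. integral {y..b} f - integral {y..b} g)"
    by (rule integral_cong)
  also have "\<dots> = integral {a..x} (\<lambda>y. integral {y..b} f) - integral {a..x} (\<lambda>y. integral {y..b} g)"
    by (intro integral_diff int f g)
  finally show ?thesis ..
qed

text \<open>Banach's fixed point theorem: the condition on \<open>M\<close> makes the operator map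
  the ball of radius \<open>r\<close> about \<open>c\<close> into itself, and the condition on
  \<open>K\<close> makes it a contraction there. Both boundary conditions are built into the
  operator: the outer integral starts at \<open>a\<close>, the inner one ends at
  \<open>b\<close>.\<close>

lemma mixed_bvp_solution:
  fixes h :: "real \<Rightarrow> real \<Rightarrow> real" and a b c r M K :: real
  assumes "a \<le> b" "0 \<le> r" "0 \<le> K"
    and cont: "continuous_on ({a..b} \<times> cball c r) (\<lambda>(t, y). h t y)"
    and bound: "\<And>t y. t \<in> {a..b} \<Longrightarrow> y \<in> cball c r \<Longrightarrow> \<bar>h t y\<bar> \<le> M"
    and lip: "\<And>t y z. t \<in> {a..b} \<Longrightarrow> y \<in> cball c r \<Longrightarrow> z \<in> cball c r \<Longrightarrow>
      \<bar>h t y - h t z\<bar> \<le> K * \<bar>y - z\<bar>"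
    and M: "M * (b - a)\<^sup>2 \<le> r" and K: "K * (b - a)\<^sup>2 < 1"
  obtains v w where
    "\<And>x. x \<in> {a..b} \<Longrightarrow> v x \<in> cball c r"
    "\<And>x. x \<in> {a..b} \<Longrightarrow> (v has_real_derivative w x) (at x within {a..b})"
    "\<And>x. x \<in> {a..b} \<Longrightarrow> (w has_real_derivative h x (v x)) (at x within {a..b})"
    "v a = c" "w b = 0"
proof -
  \<comment> \<open>The complete space is that of bounded continuous functions on the whole line
    with the supremum metric, so membership in \<open>S\<close> is a pointwise condition on all
    reals.\<close>
  define S where "S = cball (const_bcontfun c :: real \<Rightarrow>\<^sub>C real) r"
  define D where "D u x = integral {a..x} (\<lambda>y. integral {y..b} (\<lambda>t. h t (u t)))"
    for u :: "real \<Rightarrow>\<^sub>C real" and x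
  have in_S: "u x \<in> cball c r" if "u \<in> S" for u :: "real \<Rightarrow>\<^sub>C real" and x
    using dist_bounded[of "const_bcontfun c" x u] that
    by (auto simp: S_def const_bcontfun.rep_eq)
  have S_I: "u \<in> S" if "\<And>x. u x \<in> cball c r" for u :: "real \<Rightarrow>\<^sub>C real"
    using that by (auto simp: S_def const_bcontfun.rep_eq intro!: dist_bound)
  have cont_h: "continuous_on {a..b} (\<lambda>t. h t (u t))" if "u \<in> S" for u :: "real \<Rightarrow>\<^sub>C real"
  proof -
    have "continuous_on {a..b} (\<lambda>t. (\<lambda>(t, y). h t y) (t, u t))"
      using in_S[OF that]
      by (intro continuous_on_compose2[OF cont] continuous_intros) auto
    then show ?thesis by simp
  qed
  \<comment> \<open>\<open>D u\<close> is controlled on \<open>{a..b}\<close> only. Composing with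
    \<open>clamp\<close> freezes the endpoint values outside, which yields a bounded continuous
    function on the line.\<close>
  have "\<exists>Tu :: real \<Rightarrow>\<^sub>C real. \<forall>x. Tu x = c - D u (clamp a b x)" if "u \<in> S" for u :: "real \<Rightarrow>\<^sub>C real"
  proof -
    have "continuous_on (cbox a b) (\<lambda>x. c - D u x)"
      unfolding D_def cbox_interval
      by (intro continuous_intros continuous_on_iterated_integral cont_h that)
    from continuous_on_cbox_bcontfunE[OF this] show ?thesis by metis
  qed
  then obtain T :: "(real \<Rightarrow>\<^sub>C real) \<Rightarrow> real \<Rightarrow>\<^sub>C real"
    where T: "\<And>u x. u \<in> S \<Longrightarrow> T u x = c - D u (clamp a b x)"
    by metis
  have clamp: "clamp a b x \<in> {a..b}" for x
    using clamp_in_interval[of a b x] \<open>a \<le> b\<close> by simp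
  have "\<exists>!u\<in>S. T u = u"
  proof (rule Banach_fix)
    show "complete S"
      by (simp add: S_def complete_eq_closed)
    show "S \<noteq> {}"
      using \<open>0 \<le> r\<close> by (auto simp: S_def)
    show "0 \<le> K * (b - a)\<^sup>2"
      using \<open>0 \<le> K\<close> by simp
    show "T ` S \<subseteq> S"
    proof (clarify intro!: S_I)
      fix u x assume u: "u \<in> S"
      have "\<bar>D u (clamp a b x)\<bar> \<le> M * (b - a)\<^sup>2"
        unfolding D_def using u in_S
        by (intro abs_iterated_integral_le cont_h bound clamp) auto
      then show "T u x \<in> cball c r"
        using M by (simp add: T[OF u] dist_real_def)
    qed
    show "dist (T u) (T v) \<le> K * (b - a)\<^sup>2 * dist u v" if u: "u \<in> S" and v: "v \<in> S" for u v
    proof (rule dist_bound)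
      fix x
      \<comment> \<open>This bound is uniform in \<open>t\<close>, so it can play the role of
        \<open>M\<close> in \<open>abs_iterated_integral_le\<close>.\<close>
      have "\<bar>h t (u t) - h t (v t)\<bar> \<le> K * dist u v" if "t \<in> {a..b}" for t
      proof -
        have "\<bar>h t (u t) - h t (v t)\<bar> \<le> K * \<bar>u t - v t\<bar>"
          by (intro lip that in_S u v)
        also have "\<dots> \<le> K * dist u v"
          using dist_bounded[of u t v] \<open>0 \<le> K\<close> by (intro mult_left_mono) (auto simp: dist_real_def)
        finally show ?thesis .
      qed
      then have "\<bar>D u (clamp a b x) - D v (clamp a b x)\<bar> \<le> K * dist u v * (b - a)\<^sup>2"
        unfolding D_def iterated_integral_diff[OF cont_h[OF u] cont_h[OF v] clamp]
        by (intro abs_iterated_integral_le continuous_intros cont_h u v clamp)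
      then show "dist (T u x) (T v x) \<le> K * (b - a)\<^sup>2 * dist u v"
        by (simp add: T u v dist_real_def abs_minus_commute mult_ac)
    qed
  qed (use K in auto)
  then obtain u where u: "u \<in> S" "T u = u"
    by blast
  have u_eq: "u x = c - D u x" if "x \<in> {a..b}" for x
    using T[OF u(1), of x] that by (simp add: u(2))
  define w where "w y = - integral {y..b} (\<lambda>t. h t (u t))" for y
  show thesis
  proof
    show "u x \<in> cball c r" for x
      using u(1) by (rule in_S)
    show "u a = c"
      using u_eq[of a] \<open>a \<le> b\<close> by (simp add: D_def)
    show "w b = 0"
      by (simp add: w_def)
    show w': "(w has_real_derivative h x (u x)) (at x within {a..b})" if "x \<in> {a..b}" for x
      using DERIV_minus[OF integral_has_real_derivative'[OF cont_h[OF u(1)] that]]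
      by (simp add: w_def [abs_def])
    show "(u has_real_derivative w x) (at x within {a..b})" if x: "x \<in> {a..b}" for x
    proof -
      have "continuous_on {a..b} (\<lambda>y. integral {y..b} (\<lambda>t. h t (u t)))"
        by (intro indefinite_integral_continuous_1' integrable_continuous_real cont_h u)
      from integral_has_real_derivative[OF this x]
      have "((\<lambda>x. c - D u x) has_real_derivative w x) (at x within {a..b})"
        unfolding D_def w_def by (auto intro!: derivative_eq_intros)
      \<comment> \<open>The fixed point equals \<open>c - D u\<close> only on \<open>{a..b}\<close>,
        which is enough for a derivative taken within that set.\<close>
      then show ?thesis
        using u_eq x by (subst has_field_derivative_cong_eventually) 
         (auto simp: eventually_at_filter)
    qed
  qed
qed

text \<open>The reciprocals \<open>p\<close>, \<open>q\<close> lie in (0, 2]. Hence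
  \<open>p - q = p * q * (z - y)\<close> gives the factor 4, and in the factorization of
  \<open>p ^ 3 - q ^ 3\<close> the quadratic factor is at most 12, which gives 12 * 4 = 48. The
  threshold 1/2 is the lowest point of the ball of radius 1/2 about 1.\<close>

lemma abs_inverse_diff_le:
  fixes y z :: real
  assumes "1/2 \<le> y" "1/2 \<le> z"
  shows "\<bar>1 / y - 1 / z\<bar> \<le> 4 * \<bar>y - z\<bar>"
    and "\<bar>1 / y ^ 3 - 1 / z ^ 3\<bar> \<le> 48 * \<bar>y - z\<bar>"
proof -
  define p q where "p = 1 / y" and "q = 1 / z"
  have p: "0 < p" "p \<le> 2" and q: "0 < q" "q \<le> 2"
    using assms by (auto simp: p_def q_def field_simps)
  have pq: "p * q \<le> 2 * 2"
    using p q by (intro mult_mono) auto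
  have "p - q = p * q * (z - y)"
    using assms by (simp add: p_def q_def field_simps)
  then have "\<bar>p - q\<bar> = p * q * \<bar>y - z\<bar>"
    using p q by (simp add: abs_mult abs_minus_commute)
  also have "\<dots> \<le> 4 * \<bar>y - z\<bar>"
    using pq by (intro mult_right_mono) auto
  finally show 1: "\<bar>1 / y - 1 / z\<bar> \<le> 4 * \<bar>y - z\<bar>"
    by (simp add: p_def q_def)
  have sq: "p * p \<le> 2 * 2" "q * q \<le> 2 * 2"
    using p q by (intro mult_mono; simp)+
  have "p ^ 3 - q ^ 3 = (p * p + p * q + q * q) * (p - q)"
    by (simp add: power3_eq_cube algebra_simps)
  then have "\<bar>p ^ 3 - q ^ 3\<bar> = (p * p + p * q + q * q) * \<bar>p - q\<bar>"
    using p q by (simp add: abs_mult)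
  also have "\<dots> \<le> 12 * (4 * \<bar>y - z\<bar>)"
    using 1 pq sq p q by (intro mult_mono) (auto simp: p_def q_def)
  finally show "\<bar>1 / y ^ 3 - 1 / z ^ 3\<bar> \<le> 48 * \<bar>y - z\<bar>"
    by (simp add: p_def q_def power_one_over)
qed

lemma C1_on_IccI:
  assumes "\<And>x. x \<in> {a..b} \<Longrightarrow> (f has_real_derivative f' x) (at x within {a..b})"
    and "continuous_on {a..b} f'"
  shows "C1_on_Icc a b f"
  using assms unfolding C1_on_Icc_def by blast

theorem theorem3p1:
  fixes L G B :: real and p q :: "real \<Rightarrow> real"
  assumes "0 < L"
    and "G\<^sup>2 + B\<^sup>2 \<noteq> 0"
    and "continuous_on {0..L} p"
    and "continuous_on {0..L} q"
  shows "\<exists>\<epsilon>>0. \<exists>\<theta> v s w :: real \<Rightarrow> real.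
    C1_on_Icc 0 L \<theta> \<and> C1_on_Icc 0 L v \<and> C1_on_Icc 0 L s \<and> C1_on_Icc 0 L w \<and>
    (\<forall>x\<in>{0..L}. v x \<noteq> 0) \<and>
    (\<forall>x\<in>{0..L}.
       (\<theta> has_real_derivative - (s x / (v x)\<^sup>2)) (at x within {0..L}) \<and>
       (v has_real_derivative w x) (at x within {0..L}) \<and>
       (s has_real_derivative \<epsilon> * ((B * p x - G * q x) / (G\<^sup>2 + B\<^sup>2))) (at x within {0..L}) \<and>
       (w has_real_derivative
          (s x)\<^sup>2 / (v x) ^ 3 - \<epsilon> * ((G * p x + B * q x) / (v x * (G\<^sup>2 + B\<^sup>2))))
         (at x within {0..L})) \<and>
    \<theta> 0 = 0 \<and> v 0 = 1 \<and> s L = 0 \<and> w L = 0"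
proof -
  define N where "N = G\<^sup>2 + B\<^sup>2"
  define \<alpha> where "\<alpha> x = (B * p x - G * q x) / N" for x
  define \<beta> where "\<beta> x = (G * p x + B * q x) / N" for x
  \<comment> \<open>Integrating backwards from \<open>L\<close> makes \<open>S\<close> vanish at
    \<open>L\<close>, as required of \<open>s\<close>.\<close>
  define S where "S x = - integral {x..L} \<alpha>" for x
  have N: "N \<noteq> 0"
    using assms by (simp add: N_def)
  have cont_\<alpha>: "continuous_on {0..L} \<alpha>" and cont_\<beta>: "continuous_on {0..L} \<beta>"
    unfolding \<alpha>_def \<beta>_def using N by (auto intro!: continuous_intros assms)
  have S': "(S has_real_derivative \<alpha> x) (at x within {0..L})" if "x \<in> {0..L}" for x
    using DERIV_minus[OF integral_has_real_derivative'[OF cont_\<alpha> that]]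
    by (simp add: S_def [abs_def])
  then have cont_S: "continuous_on {0..L} S"
    by (rule DERIV_continuous_on)
  obtain s0 where s0: "0 \<le> s0" "\<And>x. x \<in> {0..L} \<Longrightarrow> (S x)\<^sup>2 \<le> s0"
  proof -
    have "bounded ((\<lambda>x. (S x)\<^sup>2) ` {0..L})"
      by (intro compact_imp_bounded compact_continuous_image continuous_intros cont_S) auto
    then obtain m where "0 < m" "\<forall>x\<in>{0..L}. (S x)\<^sup>2 \<le> m"
      unfolding bounded_pos by auto
    then show thesis by (auto intro!: that[of m])
  qed
  obtain b0 where b0: "0 \<le> b0" "\<And>x. x \<in> {0..L} \<Longrightarrow> \<bar>\<beta> x\<bar> \<le> b0"
  proof -
    have "bounded (\<beta> ` {0..L})"
      by (intro compact_imp_bounded compact_continuous_image cont_\<beta>) auto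
    then obtain m where "0 < m" "\<forall>x\<in>{0..L}. \<bar>\<beta> x\<bar> \<le> m"
      unfolding bounded_pos by auto
    then show thesis by (auto intro!: that[of m])
  qed
  \<comment> \<open>The weights are the Lipschitz constants of \<open>1 / y ^ 3\<close> and
    \<open>1 / y\<close>. They also exceed the bounds 8 and 2 of these functions, so
    \<open>\<epsilon> * C\<close> serves as both \<open>M\<close> and \<open>K\<close>.
    \<open>D\<close> dominates both 1 and \<open>C * L\<^sup>2\<close>, whence
    \<open>\<epsilon> \<le> 1\<close> and
    \<open>\<epsilon> * C * L\<^sup>2 \<le> 1/2\<close>.\<close>
  define C where "C = 48 * s0 + 4 * b0"
  define D where "D = (C + 1) * (L\<^sup>2 + 1)"
  define \<epsilon> where "\<epsilon> = 1 / (2 * D)"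
  have C: "0 \<le> C"
    using s0 b0 by (simp add: C_def)
  have "1 * 1 \<le> D"
    unfolding D_def using C by (intro mult_mono) auto
  then have D: "1 \<le> D" by simp
  then have \<epsilon>: "0 < \<epsilon>" "\<epsilon> \<le> 1"
    by (auto simp: \<epsilon>_def)
  have "C * L\<^sup>2 \<le> D"
    unfolding D_def using C by (intro mult_mono) auto
  then have small: "\<epsilon> * C * L\<^sup>2 \<le> 1/2"
    using D by (simp add: \<epsilon>_def mult.assoc divide_le_eq)
  \<comment> \<open>The term from \<open>s\<close> squared is quadratic in \<epsilon>; this makes
    both coefficients of \<open>h\<close> linear in \<epsilon>.\<close>
  have \<epsilon>2: "\<epsilon>\<^sup>2 \<le> \<epsilon>"
    using \<epsilon> by (simp add: power2_eq_square mult_left_le)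
  define h where "h x y = \<epsilon>\<^sup>2 * (S x)\<^sup>2 * (1 / y ^ 3) - \<epsilon> * \<beta> x * (1 / y)" for x y
  have ball: "1/2 \<le> y" if "y \<in> cball 1 (1/2)" for y :: real
    using that unfolding mem_cball dist_real_def by linarith
  have coeff: "\<bar>\<epsilon>\<^sup>2 * (S x)\<^sup>2\<bar> \<le> \<epsilon> * s0" "\<bar>\<epsilon> * \<beta> x\<bar> \<le> \<epsilon> * b0" if "x \<in> {0..L}" for x
    using mult_mono[OF \<epsilon>2 s0(2)[OF that]] b0(2)[OF that] \<epsilon> by (auto simp: abs_mult)
  \<comment> \<open>Taking \<open>e = 1\<close> bounds \<open>h\<close> itself; taking
    \<open>e = \<bar>y - z\<bar>\<close> gives its Lipschitz estimate.\<close>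
  have diff_bound: "\<bar>\<epsilon>\<^sup>2 * (S x)\<^sup>2 * c - \<epsilon> * \<beta> x * d\<bar> \<le> \<epsilon> * C * e"
    if "x \<in> {0..L}" "\<bar>c\<bar> \<le> 48 * e" "\<bar>d\<bar> \<le> 4 * e" for x c d e
  proof -
    have "\<bar>\<epsilon>\<^sup>2 * (S x)\<^sup>2 * c - \<epsilon> * \<beta> x * d\<bar> \<le> \<bar>\<epsilon>\<^sup>2 * (S x)\<^sup>2\<bar> * \<bar>c\<bar> + \<bar>\<epsilon> * \<beta> x\<bar> * \<bar>d\<bar>"
      by (rule order_trans[OF abs_triangle_ineq4]) (simp add: abs_mult)
    also have "\<dots> \<le> (\<epsilon> * s0) * (48 * e) + (\<epsilon> * b0) * (4 * e)"
      using \<epsilon> s0(1) b0(1) by (intro add_mono mult_mono coeff that) auto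
    finally show ?thesis
      by (simp add: C_def algebra_simps)
  qed
  have cont_h: "continuous_on ({0..L} \<times> cball 1 (1/2)) (\<lambda>(t, y). h t y)"
    unfolding h_def case_prod_unfold using ball
    by (intro continuous_intros continuous_on_compose2[OF cont_S] continuous_on_compose2[OF cont_\<beta>])
      fastforce+
  have bound_h: "\<bar>h t y\<bar> \<le> \<epsilon> * C" if t: "t \<in> {0..L}" and y: "y \<in> cball 1 (1/2)" for t y
  proof -
    have inv: "0 < 1 / y" "1 / y \<le> 2"
      using ball[OF y] by (auto simp: field_simps)
    then have "(1 / y) ^ 3 \<le> 2 ^ 3"
      by (intro power_mono) auto
    then show ?thesis
      unfolding h_def using diff_bound[OF t, of "1 / y ^ 3" 1 "1 / y"] inv
      by (simp add: power_one_over abs_le_iff)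
  qed
  have lip_h: "\<bar>h t y - h t z\<bar> \<le> \<epsilon> * C * \<bar>y - z\<bar>"
    if t: "t \<in> {0..L}" and y: "y \<in> cball 1 (1/2)" and z: "z \<in> cball 1 (1/2)" for t y z
  proof -
    have "h t y - h t z = \<epsilon>\<^sup>2 * (S t)\<^sup>2 * (1 / y ^ 3 - 1 / z ^ 3) - \<epsilon> * \<beta> t * (1 / y - 1 / z)"
      unfolding h_def by (simp only: right_diff_distrib)
    then show ?thesis
      by (simp only: diff_bound[OF t] abs_inverse_diff_le[OF ball[OF y] ball[OF z]])
  qed
  obtain v w where v_ball: "\<And>x. x \<in> {0..L} \<Longrightarrow> v x \<in> cball 1 (1/2)"
    and v': "\<And>x. x \<in> {0..L} \<Longrightarrow> (v has_real_derivative w x) (at x within {0..L})"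
    and w': "\<And>x. x \<in> {0..L} \<Longrightarrow> (w has_real_derivative h x (v x)) (at x within {0..L})"
    and bc: "v 0 = 1" "w L = 0"
  proof (rule mixed_bvp_solution[OF _ _ _ cont_h bound_h lip_h])
    show "\<epsilon> * C * (L - 0)\<^sup>2 \<le> 1/2" "\<epsilon> * C * (L - 0)\<^sup>2 < 1"
      using small by auto
  qed (use assms \<epsilon> C in auto)
  have v0: "v x \<noteq> 0" if "x \<in> {0..L}" for x
    using ball[OF v_ball[OF that]] by auto
  \<comment> \<open>Continuity of \<open>w\<close>, the derivative of \<open>v\<close>, is what
    makes \<open>v\<close> of class C^1.\<close>
  have cont_v: "continuous_on {0..L} v" and cont_w: "continuous_on {0..L} w"
    by (rule DERIV_continuous_on[OF v'], simp) (rule DERIV_continuous_on[OF w'], simp)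
  define s where "s x = \<epsilon> * S x" for x
  have s': "(s has_real_derivative \<epsilon> * \<alpha> x) (at x within {0..L})" if "x \<in> {0..L}" for x
    unfolding s_def using S'[OF that] by (auto intro!: derivative_eq_intros)
  have cont_s: "continuous_on {0..L} s"
    unfolding s_def by (intro continuous_intros cont_S)
  have cont_\<theta>': "continuous_on {0..L} (\<lambda>x. - (s x / (v x)\<^sup>2))"
    using v0 by (intro continuous_intros cont_s cont_v) auto
  define \<theta> where "\<theta> x = integral {0..x} (\<lambda>x. - (s x / (v x)\<^sup>2))" for x
  have \<theta>': "(\<theta> has_real_derivative - (s x / (v x)\<^sup>2)) (at x within {0..L})" if "x \<in> {0..L}" for x
    unfolding \<theta>_def by (rule integral_has_real_derivative[OF cont_\<theta>' that])
  have cont_w': "continuous_on {0..L} (\<lambda>x. h x (v x))"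
    unfolding h_def using v0 by (intro continuous_intros cont_S cont_\<beta> cont_v) auto
  \<comment> \<open>Substituting \<open>s = \<epsilon> * S\<close> restores the original equation
    for \<open>w\<close>.\<close>
  have h_eq: "h x (v x) = (s x)\<^sup>2 / (v x) ^ 3 - \<epsilon> * ((G * p x + B * q x) / (v x * (G\<^sup>2 + B\<^sup>2)))" for x
    by (simp add: h_def s_def \<beta>_def N_def power_mult_distrib mult.commute)
  show ?thesis
  proof (rule exI[of _ \<epsilon>], rule conjI, rule \<epsilon>(1), rule exI[of _ \<theta>], rule exI[of _ v],
      rule exI[of _ s], rule exI[of _ w], intro conjI ballI)
    show "C1_on_Icc 0 L \<theta>" "C1_on_Icc 0 L v" "C1_on_Icc 0 L w"
      using C1_on_IccI[OF \<theta>' cont_\<theta>'] C1_on_IccI[OF v' cont_w] C1_on_IccI[OF w' cont_w'] by auto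
    show "C1_on_Icc 0 L s"
      by (rule C1_on_IccI[OF s'], simp) (intro continuous_intros cont_\<alpha>)
  qed (use v0 \<theta>' v' s' w' bc in \<open>auto simp: \<theta>_def s_def S_def \<alpha>_def N_def h_eq\<close>)
qed

end
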